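(* For $r>0$ let $\mathcal{A}(r,\boldsymbol{\theta}_0)=\{\boldsymbol{\theta}\in\Theta:\mathfrak{M}(\boldsymbol{\theta},\boldsymbol{\theta}_0)\le r\}$. For any $\rho,s\in[0,1)$ and $r>0$, $$\mathbb{P}\big(\widetilde{\boldsymbol{\theta}}\notin\mathcal{A}(r,\boldsymbol{\theta}_0)\big)\le\mathfrak{Q}(\rho,s)\exp(-\rho s r).$$
   Context: $L(\boldsymbol{\theta})$, $\boldsymbol{\theta}\in\Theta\subset\mathbb{R}^p$, is a separable real-valued random field on a probability space $(\Omega,\mathcal{F},\mathbb{P})$ with expectation $\mathbb{E}$, and $\mathbb{E}L(\boldsymbol{\theta})$ exists for all $\boldsymbol{\theta}\in\Theta$. Notation: $L(\boldsymbol{\theta},\boldsymbol{\theta}')=L(\boldsymbol{\theta})-L(\boldsymbol{\theta}')$. The point $\boldsymbol{\theta}_0\in\Theta$ is a maximizer of $\boldsymbol{\theta}\mapsto\mathbb{E}L(\boldsymbol{\theta})$, and the (random) minimum contrast estimator $\widetilde{\boldsymbol{\theta}}\in\Theta$ is a maximizer of $\boldsymbol{\theta}\mapsto L(\boldsymbol{\theta})$ over $\Theta$. It is assumed that for every $\boldsymbol{\theta}\in\Theta$ the set $\Upsilon(\boldsymbol{\theta})=\{\mu\in(0,\infty):\mathbb{E}\exp\{\mu L(\boldsymbol{\theta},\boldsymbol{\theta}_0)\}<\infty\}$ is non-empty; a function $\mu(\cdot)$ with $\mu(\boldsymbol{\theta})\in\Upsilon(\boldsymbol{\theta})$ is fixed,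 and $\mathfrak{M}(\boldsymbol{\theta},\boldsymbol{\theta}_0)=-\log\mathbb{E}\exp\{\mu(\boldsymbol{\theta})L(\boldsymbol{\theta},\boldsymbol{\theta}_0)\}$. For $\rho,s\in[0,1]$, $$\mathfrak{Q}(\rho,s)=\mathbb{E}\sup_{\boldsymbol{\theta}\in\Theta}\exp\Big\{\rho\big[\mu(\boldsymbol{\theta})L(\boldsymbol{\theta},\boldsymbol{\theta}_0)+s\,\mathfrak{M}(\boldsymbol{\theta},\boldsymbol{\theta}_0)\big]\Big\}.$$ *)

theory Defs
  imports "HOL-Probability.Probability"
begin

text \<open>
  Separability in the sense of Doob, as used for random fields by Adler and Taylor: outside one
  fixed null set, the values on the countable dense set \<open>D\<close> of index points decide, for all open
  \<open>G\<close> and closed \<open>B\<close> simultaneously, whether the field stays in \<open>B\<close> throughout \<open>G \<inter> T\<close>.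
\<close>
definition separable_random_field ::
    "'w measure \<Rightarrow> 't::topological_space set \<Rightarrow> ('t \<Rightarrow> 'w \<Rightarrow> real) \<Rightarrow> bool" where
  "separable_random_field M T L \<longleftrightarrow>
     (\<forall>t\<in>T. L t \<in> borel_measurable M) \<and>
     (\<exists>D N. countable D \<and> D \<subseteq> T \<and> T \<subseteq> closure D \<and> N \<in> null_sets M \<and>
        (\<forall>\<omega>\<in>space M - N. \<forall>G B. open G \<longrightarrow> closed B \<longrightarrow>
           ((\<forall>t\<in>G \<inter> D. L t \<omega> \<in> B) \<longleftrightarrow> (\<forall>t\<in>G \<inter> T. L t \<omega> \<in> B))))"

definition exp_moment_set ::
    "'w measure \<Rightarrow> ('t \<Rightarrow> 'w \<Rightarrow> real) \<Rightarrow> 't \<Rightarrow> 't \<Rightarrow> real set" where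
  "exp_moment_set M L \<theta>\<^sub>0 \<theta> =
     {m. 0 < m \<and> (\<integral>\<^sup>+\<omega>. ennreal (exp (m * (L \<theta> \<omega> - L \<theta>\<^sub>0 \<omega>))) \<partial>M) < \<infinity>}"

definition rate_function ::
    "'w measure \<Rightarrow> ('t \<Rightarrow> 'w \<Rightarrow> real) \<Rightarrow> ('t \<Rightarrow> real) \<Rightarrow> 't \<Rightarrow> 't \<Rightarrow> real" where
  "rate_function M L \<mu> \<theta>\<^sub>0 \<theta> = - ln (\<integral>\<omega>. exp (\<mu> \<theta> * (L \<theta> \<omega> - L \<theta>\<^sub>0 \<omega>)) \<partial>M)"

text \<open>
  The expectation may be infinite, so it takes values in \<^typ>\<open>ennreal\<close>. The pointwise supremum need
  not be measurable for arbitrary \<open>\<mu>\<close>; in that case the integral is the lower integral, which only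
  makes an upper bound by it stronger.
\<close>
definition sup_exp_moment ::
    "'w measure \<Rightarrow> 't set \<Rightarrow> ('t \<Rightarrow> 'w \<Rightarrow> real) \<Rightarrow> ('t \<Rightarrow> real) \<Rightarrow> 't \<Rightarrow> real \<Rightarrow> real \<Rightarrow> ennreal" where
  "sup_exp_moment M \<Theta> L \<mu> \<theta>\<^sub>0 \<rho> s =
     (\<integral>\<^sup>+\<omega>. (SUP \<theta>\<in>\<Theta>. ennreal (exp (\<rho> * (\<mu> \<theta> * (L \<theta> \<omega> - L \<theta>\<^sub>0 \<omega>)
                                        + s * rate_function M L \<mu> \<theta>\<^sub>0 \<theta>)))) \<partial>M)"

definition rate_sublevel ::
    "'w measure \<Rightarrow> 't set \<Rightarrow> ('t \<Rightarrow> 'w \<Rightarrow> real) \<Rightarrow> ('t \<Rightarrow> real) \<Rightarrow> real \<Rightarrow> 't \<Rightarrow> 't set" where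
  "rate_sublevel M \<Theta> L \<mu> r \<theta>\<^sub>0 = {\<theta>\<in>\<Theta>. rate_function M L \<mu> \<theta>\<^sub>0 \<theta> \<le> r}"

end

theory Submission
  imports Defs
begin

text \<open>
  The estimator maximizes \<open>L\<close> over a set that contains \<open>\<theta>\<^sub>0\<close>, so the contrast
  \<open>L (\<theta>_est \<omega>) \<omega> - L \<theta>\<^sub>0 \<omega>\<close> is never negative, and the weight \<open>\<mu>\<close> is positive. If \<open>\<theta>_est \<omega>\<close> leaves
  the sublevel set then the rate function at \<open>\<theta>_est \<omega>\<close> exceeds \<open>r\<close>, and the exponent
  \<open>\<rho> * (\<mu> \<theta> * (L \<theta> \<omega> - L \<theta>\<^sub>0 \<omega>) + s * rate_function M L \<mu> \<theta>\<^sub>0 \<theta>)\<close> at \<open>\<theta> = \<theta>_est \<omega>\<close> is at least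
  \<open>\<rho> * s * r\<close>. The supremum over \<open>\<theta>\<close> can only be larger, so it is at least \<open>exp (\<rho> * s * r)\<close> on
  the deviation event (\<open>exp_le_SUP_exp_of_deviation\<close>), and Markov's inequality
  (\<open>Markov_lower_integral\<close>) finishes the proof.
\<close>

text \<open>
  A supremum over an uncountable set need not be measurable, so Markov's inequality is needed for
  the lower integral of an arbitrary function. Monotonicity suffices for this: the constant times
  the indicator of \<open>A\<close> is a measurable minorant of \<open>f\<close>. If \<open>A\<close> is not measurable, then its
  \<^const>\<open>emeasure\<close> is \<open>0\<close> by convention.
\<close>
lemma Markov_lower_integral:
  fixes f :: "'w \<Rightarrow> ennreal"
  assumes "\<And>\<omega>. \<omega> \<in> A \<Longrightarrow> c \<le> f \<omega>"
  shows "c * emeasure M A \<le> (\<integral>\<^sup>+\<omega>. f \<omega> \<partial>M)"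
proof (cases "A \<in> sets M")
  case True
  then have "c * emeasure M A = (\<integral>\<^sup>+\<omega>. c * indicator A \<omega> \<partial>M)"
    by (simp add: nn_integral_cmult_indicator)
  also have "\<dots> \<le> (\<integral>\<^sup>+\<omega>. f \<omega> \<partial>M)"
    by (intro nn_integral_mono) (use assms in \<open>auto simp: indicator_def\<close>)
  finally show ?thesis .
next
  case False
  then show ?thesis
    by (simp add: emeasure_notin_sets)
qed

text \<open>
  The supremum is bounded from below by its term at a single point \<open>t\<close> outside the sublevel set.
  The contrast part of the exponent is nonnegative there, which leaves the rate as the lower bound.
\<close>
lemma exp_le_SUP_exp_of_deviation:
  fixes c K :: "'t \<Rightarrow> real"
  assumes "t \<in> T" and "0 \<le> c t" and "r \<le> K t" and "0 \<le> \<rho>" and "0 \<le> s"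
  shows "ennreal (exp (\<rho> * s * r)) \<le> (SUP t\<in>T. ennreal (exp (\<rho> * (c t + s * K t))))"
proof (rule SUP_upper2[OF \<open>t \<in> T\<close>])
  have "s * r \<le> c t + s * K t"
    using assms mult_left_mono[of r "K t" s] by linarith
  then have "\<rho> * s * r \<le> \<rho> * (c t + s * K t)"
    using \<open>0 \<le> \<rho>\<close> by (simp add: mult.assoc mult_left_mono)
  then show "ennreal (exp (\<rho> * s * r)) \<le> ennreal (exp (\<rho> * (c t + s * K t)))"
    by (simp add: ennreal_leI)
qed

theorem corollary2p5:
  fixes M :: "'w measure"
    and \<Theta> :: "(real ^ 'p) set"
    and L :: "real ^ 'p \<Rightarrow> 'w \<Rightarrow> real"
    and \<theta>\<^sub>0 :: "real ^ 'p"
    and \<theta>_est :: "'w \<Rightarrow> real ^ 'p"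
    and \<mu> :: "real ^ 'p \<Rightarrow> real"
    and \<rho> s r :: real
  assumes "prob_space M"
    and "separable_random_field M \<Theta> L"
    and "\<And>\<theta>. \<theta> \<in> \<Theta> \<Longrightarrow> integrable M (L \<theta>)"
    and "\<theta>\<^sub>0 \<in> \<Theta>"
    and "\<And>\<theta>. \<theta> \<in> \<Theta> \<Longrightarrow> (\<integral>\<omega>. L \<theta> \<omega> \<partial>M) \<le> (\<integral>\<omega>. L \<theta>\<^sub>0 \<omega> \<partial>M)"
    and "\<theta>_est \<in> borel_measurable M"
    and "\<And>\<omega>. \<omega> \<in> space M \<Longrightarrow> \<theta>_est \<omega> \<in> \<Theta>"
    and "\<And>\<omega> \<theta>. \<omega> \<in> space M \<Longrightarrow> \<theta> \<in> \<Theta> \<Longrightarrow> L \<theta> \<omega> \<le> L (\<theta>_est \<omega>) \<omega>"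
    and "\<And>\<theta>. \<theta> \<in> \<Theta> \<Longrightarrow> exp_moment_set M L \<theta>\<^sub>0 \<theta> \<noteq> {}"
    and "\<And>\<theta>. \<theta> \<in> \<Theta> \<Longrightarrow> \<mu> \<theta> \<in> exp_moment_set M L \<theta>\<^sub>0 \<theta>"
    and "\<rho> \<in> {0..<1}"
    and "s \<in> {0..<1}"
    and "r > 0"
  shows "emeasure M {\<omega> \<in> space M. \<theta>_est \<omega> \<notin> rate_sublevel M \<Theta> L \<mu> r \<theta>\<^sub>0}
           \<le> sup_exp_moment M \<Theta> L \<mu> \<theta>\<^sub>0 \<rho> s * ennreal (exp (- \<rho> * s * r))"
proof -
  define E where "E = {\<omega> \<in> space M. \<theta>_est \<omega> \<notin> rate_sublevel M \<Theta> L \<mu> r \<theta>\<^sub>0}"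
  define Q where "Q = sup_exp_moment M \<Theta> L \<mu> \<theta>\<^sub>0 \<rho> s"
  have "ennreal (exp (\<rho> * s * r)) * emeasure M E \<le> Q"
    unfolding Q_def sup_exp_moment_def
  proof (rule Markov_lower_integral)
    fix \<omega> assume "\<omega> \<in> E"
    then have \<omega>: "\<omega> \<in> space M" and "\<theta>_est \<omega> \<notin> rate_sublevel M \<Theta> L \<mu> r \<theta>\<^sub>0"
      by (auto simp: E_def)
    have est: "\<theta>_est \<omega> \<in> \<Theta>"
      using assms(7) \<omega> .
    then have "r \<le> rate_function M L \<mu> \<theta>\<^sub>0 (\<theta>_est \<omega>)"
      using \<open>\<theta>_est \<omega> \<notin> _\<close> by (simp add: rate_sublevel_def)
    moreover have "0 < \<mu> (\<theta>_est \<omega>)"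
      using assms(10)[OF est] by (simp add: exp_moment_set_def)
    then have "0 \<le> \<mu> (\<theta>_est \<omega>) * (L (\<theta>_est \<omega>) \<omega> - L \<theta>\<^sub>0 \<omega>)"
      using assms(8)[OF \<omega> assms(4)] by simp
    ultimately show "ennreal (exp (\<rho> * s * r)) \<le>
        (SUP \<theta>\<in>\<Theta>. ennreal (exp (\<rho> * (\<mu> \<theta> * (L \<theta> \<omega> - L \<theta>\<^sub>0 \<omega>)
                                     + s * rate_function M L \<mu> \<theta>\<^sub>0 \<theta>))))"
      using est assms(11,12) by (intro exp_le_SUP_exp_of_deviation) auto
  qed
  moreover have "ennreal (exp (\<rho> * s * r)) * ennreal (exp (- \<rho> * s * r)) = 1"
    by (subst ennreal_mult[symmetric]) (simp_all add: exp_add[symmetric])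
  then have "emeasure M E
      = ennreal (exp (\<rho> * s * r)) * emeasure M E * ennreal (exp (- \<rho> * s * r))"
    by (metis mult.assoc mult.commute mult_1)
  ultimately show ?thesis
    unfolding E_def[symmetric] Q_def[symmetric] by (metis mult_right_mono zero_le)
qed

end
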